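(* Let $n,k$ be integers with $3\le k\le n-1$, and let $\mathcal X\subset\mathbb R^2$ be an $n$-independent set of exactly $d(n,k-2)+2$ nodes. Then there exist four linearly independent curves of degree less than or equal to $k$ passing through all the nodes of $\mathcal X$ if and only if all the nodes of $\mathcal X$ but two lie in a maximal curve of degree $k-2$ (that is, there is a curve of degree $k-2$ which passes through exactly $d(n,k-2)$ nodes of $\mathcal X$, and the remaining two nodes lie outside it).
   Context: $\Pi_n$ denotes the space of all bivariate real polynomials of total degree $\le n$, and $N_n=\dim\Pi_n=\tfrac12(n+1)(n+2)$. For $k\le n$, $d(n,k):=N_n-N_{n-k}=\tfrac12k(2n+3-k)$; in particular $d(n,k-2)=(n+1)+n+\cdots+(n-k+4)$. A node set is a finite set of distinct points of the plane. A polynomial $p\in\Pi_n$ is an ($n$-)fundamental polynomial for $A\in\mathcal X$ if $p(A)=1$ and $p$ vanishes on $\mathcal X\setminus\{A\}$. The set $\mathcal X$ is $n$-independent if each of its nodes has a fundamental polynomial in $\Pi_n$. A (plane algebraic) curve is the zero set of a bivariate polynomial of degree $\ge1$; the same letter is used for the polynomial and the curve, the degree of the curve is that of the polynomial, and linear independence of curves means linear independence of the polynomials. A curve passes through a node if its polynomial vanishes there. Given an $n$-independent set $\mathcal X$ with $|\mathcal X|\ge d(n,m)$, a curve of degree $m\le n$ passing through $d(n,m)$ points of $\mathcal X$ is called maximal (a curve of degree $m$ can never contain more than $d(n,m)$ nodes of an $n$-independent set). *)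

theory Defs
  imports "HOL-Computational_Algebra.Computational_Algebra"
begin

text \<open>
  A bivariate real polynomial is a polynomial in $y$ whose coefficients are polynomials in $x$:
  \<open>coeff (coeff p j) i\<close> is the coefficient of $x^i y^j$ in \<open>p\<close>.
\<close>

type_synonym bipoly = "real poly poly"

definition eval :: "bipoly \<Rightarrow> real \<times> real \<Rightarrow> real" where
  "eval p A = poly (poly p [:snd A:]) (fst A)"

text \<open>The total degree; by convention the zero polynomial has degree 0.\<close>

definition total_degree :: "bipoly \<Rightarrow> nat" where
  "total_degree p = Max (insert 0 {i + j | i j. coeff (coeff p j) i \<noteq> 0})"

definition Pi_space :: "nat \<Rightarrow> bipoly set" where
  "Pi_space n = {p. total_degree p \<le> n}"

lemma finite_exponents: "finite {i + j | i j. coeff (coeff (p :: bipoly) j) i \<noteq> 0}"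
proof -
  have "{i + j | i j. coeff (coeff p j) i \<noteq> 0}
      \<subseteq> (\<Union>j\<le>degree p. (\<lambda>i. i + j) ` {..degree (coeff p j)})"
  proof
    fix s assume "s \<in> {i + j | i j. coeff (coeff p j) i \<noteq> 0}"
    then obtain i j where ij: "s = i + j" "coeff (coeff p j) i \<noteq> 0" by blast
    then have "coeff p j \<noteq> 0" by auto
    with ij show "s \<in> (\<Union>j\<le>degree p. (\<lambda>i. i + j) ` {..degree (coeff p j)})"
      by (auto intro!: bexI[of _ j] le_degree)
  qed
  then show ?thesis by (rule finite_subset) auto
qed

lemma mem_Pi_space_iff:
  "p \<in> Pi_space n \<longleftrightarrow> (\<forall>i j. coeff (coeff p j) i \<noteq> 0 \<longrightarrow> i + j \<le> n)"
  unfolding Pi_space_def total_degree_def using finite_exponents[of p] by (auto simp: Max_le_iff)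

lemma eval_eq_sum:
  "eval p (x, y) = (\<Sum>j\<le>degree p. \<Sum>i\<le>degree (coeff p j). coeff (coeff p j) i * x ^ i * y ^ j)"
proof -
  have "poly p [:y:] = (\<Sum>j\<le>degree p. coeff p j * [:y:] ^ j)"
    by (rule poly_altdef)
  then have "eval p (x, y) = (\<Sum>j\<le>degree p. poly (coeff p j) x * y ^ j)"
    by (simp add: eval_def poly_sum)
  then show ?thesis
    by (simp add: poly_altdef[of "coeff p _"] sum_distrib_right)
qed

text \<open>Bivariate polynomials as a real vector space; this provides \<open>bipoly.independent\<close>.\<close>

interpretation bipoly: vector_space "\<lambda>(c::real) (p::bipoly). smult [:c:] p"
proof
  fix a b :: real and p q :: bipoly
  show "smult [:a:] (p + q) = smult [:a:] p + smult [:a:] q"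
    by (rule smult_add_right)
  show "smult [:a + b:] p = smult [:a:] p + smult [:b:] p"
    by (simp flip: smult_add_left)
  show "smult [:a:] (smult [:b:] p) = smult [:a * b:] p"
    by (simp add: mult.commute)
  show "smult [:1:] p = p"
    by (simp flip: one_pCons)
qed

definition N :: "nat \<Rightarrow> nat" where
  "N n = (n + 1) * (n + 2) div 2"

text \<open>Only meant for \<open>k \<le> n\<close>, where the two subtractions do not truncate.\<close>

definition d :: "nat \<Rightarrow> nat \<Rightarrow> nat" where
  "d n k = N n - N (n - k)"

lemma d_closed_form:
  assumes "k \<le> n"
  shows "d n k = k * (2 * n + 3 - k) div 2"
proof -
  obtain m where n: "n = m + k" using assms by (metis le_add_diff_inverse2)
  have e: "even ((l + 1) * (l + 2))" for l :: nat by simp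
  have "2 * N l = (l + 1) * (l + 2)" for l
    unfolding N_def using e by (rule dvd_mult_div_cancel)
  from this[of n] this[of m]
  have "2 * N n = 2 * N m + k * (2 * m + k + 3)"
    by (simp add: n algebra_simps)
  then have "k * (2 * m + k + 3) = 2 * (N n - N m)" by simp
  moreover have "2 * n + 3 - k = 2 * m + k + 3" by (simp add: n)
  moreover have "n - k = m" by (simp add: n)
  ultimately show ?thesis unfolding d_def by simp
qed

definition fundamental_polynomial ::
    "nat \<Rightarrow> (real \<times> real) set \<Rightarrow> real \<times> real \<Rightarrow> bipoly \<Rightarrow> bool" where
  "fundamental_polynomial n X A p \<longleftrightarrow>
     p \<in> Pi_space n \<and> eval p A = 1 \<and> (\<forall>B\<in>X - {A}. eval p B = 0)"

definition n_independent :: "nat \<Rightarrow> (real \<times> real) set \<Rightarrow> bool" where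
  "n_independent n X \<longleftrightarrow> (\<forall>A\<in>X. \<exists>p. fundamental_polynomial n X A p)"

text \<open>A curve is identified with its defining polynomial, which may be reducible, may have
  multiple factors, and may have few real zeros.\<close>

definition curve :: "bipoly \<Rightarrow> bool" where
  "curve p \<longleftrightarrow> 1 \<le> total_degree p"

definition nodes_on :: "bipoly \<Rightarrow> (real \<times> real) set \<Rightarrow> (real \<times> real) set" where
  "nodes_on p X = {A \<in> X. eval p A = 0}"

definition maximal_curve :: "nat \<Rightarrow> (real \<times> real) set \<Rightarrow> nat \<Rightarrow> bipoly \<Rightarrow> bool" where
  "maximal_curve n X m q \<longleftrightarrow>
     n_independent n X \<and> d n m \<le> card X \<and>
     curve q \<and> total_degree q = m \<and> m \<le> n \<and> card (nodes_on q X) = d n m"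

end

theory Submission
  imports Defs "HOL-Computational_Algebra.Field_as_Ring"
begin

text \<open>
  Let $I_j$ be the space of polynomials of degree at most $j$ vanishing on $X$, and put
  $m = n - k \ge 1$. As $X$ is $n$-independent, $\dim I_n = N_{m+2} - 2$. The dimension of
  $I_{j+1} / I_j$ is the number of independent top forms, which grows by at least one with $j$;
  if $I_{k-1}$ were zero, four independent elements of $I_k$ would therefore make $I_n$ too large.
  So there is a nonzero $r \in I_{k-1}$, and some $s \in I_k$ is not a multiple of $r$ by a
  polynomial of degree at most 1.

  Since $r \Pi_{m+1} + s \Pi_m \subseteq I_n$, counting dimensions produces many syzygies
  $s b = r a$, and these force $r = g r'$, $s = g s'$ with $\deg r' \le 1$, $\deg s' \le 2$.
  Nodes outside the curve $g$ are common zeros of $r'$ and $s'$, so there are at most two of them,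
  and $\deg g \le k - 2$. The bound $d(n, \deg g)$ on the number of nodes on $g$ then
  turns both estimates into equalities.

  Conversely, a maximal curve of degree $k - 2$ is multiplied by the four independent conics
  through the two remaining nodes.
\<close>

section \<open>Independence modulo a subspace, and multiplication by a fixed polynomial\<close>

text \<open>Serves to count dimensions in quotient spaces. The family is indexed, so the cardinality
  equation also records that \<open>c\<close> is injective on \<open>T\<close> and that its image
  avoids \<open>B\<close>.\<close>

lemma independent_mod_union:
  assumes "finite T" "bipoly.independent B" "finite B"
    and "\<And>u i. \<lbrakk>(\<Sum>i\<in>T. smult [:u i:] (c i)) \<in> bipoly.span B; i \<in> T\<rbrakk> \<Longrightarrow> u i = 0"
  shows "bipoly.independent (B \<union> c ` T) \<and> card (B \<union> c ` T) = card B + card T"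
  using assms(1,4)
proof (induction T rule: finite_induct)
  case empty
  then show ?case using assms(2) by simp
next
  case (insert a T)
  have span: "\<exists>u. x - (\<Sum>i\<in>T. smult [:u i:] (c i)) \<in> bipoly.span B"
    if "x \<in> bipoly.span (B \<union> c ` T)" for x
  proof -
    obtain y z where yz: "y \<in> bipoly.span B" "z \<in> bipoly.span (c ` T)" "x = y + z"
      using \<open>x \<in> _\<close> unfolding bipoly.span_Un by auto
    have "\<exists>u. z = (\<Sum>i\<in>T. smult [:u i:] (c i))"
      using yz(2)
    proof (induction rule: bipoly.span_induct_alt)
      case base
      have "0 = (\<Sum>i\<in>T. smult [:0::real:] (c i))" by simp
      then show ?case by (rule exI[of _ "\<lambda>_. 0"])
    next
      case (step a x y)
      then obtain j u where j: "j \<in> T" "x = c j" "y = (\<Sum>i\<in>T. smult [:u i:] (c i))" by blast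
      \<comment> \<open>Injectivity of \<open>c\<close> is not yet known, so the new scalar is added
        at one chosen index \<open>j\<close> with \<open>c j = x\<close>.\<close>
      have "(\<Sum>i\<in>T. smult [:(u(j := u j + a)) i:] (c i))
          = (\<Sum>i\<in>T - {j}. smult [:u i:] (c i)) + smult [:u j + a:] (c j)"
        using j(1) insert.hyps(1) by (simp add: sum.remove[of T j] add.commute)
      also have "\<dots> = smult [:a:] x + y"
        using j insert.hyps(1)
        by (simp add: sum.remove[of T j] bipoly.scale_left_distrib add_ac del: smult_pCons)
      finally show ?case by metis
    qed
    then show ?thesis using yz by (metis add_diff_cancel_right')
  qed
  have IH: "bipoly.independent (B \<union> c ` T) \<and> card (B \<union> c ` T) = card B + card T"
  proof (rule insert.IH)
    fix u i assume s: "(\<Sum>i\<in>T. smult [:u i:] (c i)) \<in> bipoly.span B" "i \<in> T"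
    have "(\<Sum>i\<in>insert a T. smult [:(u(a := 0)) i:] (c i)) = (\<Sum>i\<in>T. smult [:u i:] (c i))"
      using insert.hyps by (auto intro!: sum.cong)
    with s insert.prems[of "u(a := 0)" i] insert.hyps show "u i = 0" by (auto split: if_splits)
  qed
  have notin: "c a \<notin> bipoly.span (B \<union> c ` T)"
  proof
    assume "c a \<in> bipoly.span (B \<union> c ` T)"
    then obtain u where u: "c a - (\<Sum>i\<in>T. smult [:u i:] (c i)) \<in> bipoly.span B"
      using span by blast
    have "(\<Sum>i\<in>insert a T. smult [:((\<lambda>i. - u i)(a := 1)) i:] (c i))
       = c a + (\<Sum>i\<in>T. smult [:- u i:] (c i))"
      using insert.hyps by (auto intro!: sum.cong simp: one_pCons[symmetric])
    also have "\<dots> = c a - (\<Sum>i\<in>T. smult [:u i:] (c i))"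
      by (simp only: bipoly.scale_minus_left sum_negf add_uminus_conv_diff)
    finally have "((\<lambda>i. - u i)(a := 1)) a = 0" using insert.prems[of "(\<lambda>i. - u i)(a := 1)" a] u by simp
    then show False by simp
  qed
  then have notin': "c a \<notin> B \<union> c ` T" using bipoly.span_base[of "c a" "B \<union> c ` T"] by argo
  have eq: "B \<union> c ` insert a T = insert (c a) (B \<union> c ` T)" by simp
  have fin: "finite (B \<union> c ` T)" using insert.hyps(1) \<open>finite B\<close> by simp
  show ?case
    unfolding eq using IH notin notin' insert.hyps fin
    by (metis Suc_eq_plus1 add.assoc bipoly.independent_insertI card_insert_disjoint)
qed

lemma linear_mult: "Vector_Spaces.linear (\<lambda>c (p::bipoly). smult [:c:] p) (\<lambda>c p. smult [:c:] p) ((*) q)"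
  by unfold_locales (simp_all add: algebra_simps)

lemma vector_space_bipoly: "vector_space (\<lambda>c (p::bipoly). smult [:c:] p)"
  by unfold_locales

lemma independent_mult_image:
  assumes "bipoly.independent A" "q \<noteq> 0"
  shows "bipoly.independent ((*) q ` A)"
proof -
  have "vector_space_pair (\<lambda>c (p::bipoly). smult [:c:] p) (\<lambda>c (p::bipoly). smult [:c:] p)"
    by (simp add: vector_space_pair_def vector_space_bipoly)
  from vector_space_pair.linear_independent_injective_image[OF this linear_mult assms(1)]
  show ?thesis using assms(2) by (auto simp: inj_on_def)
qed

lemma card_mult_image:
  fixes A :: "bipoly set"
  assumes "q \<noteq> 0" shows "card ((*) q ` A) = card A"
  using assms by (intro card_image) (auto simp: inj_on_def)

lemma span_mult_image: "bipoly.span ((*) q ` A) = (*) q ` bipoly.span A"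
proof -
  have "vector_space_pair (\<lambda>c (p::bipoly). smult [:c:] p) (\<lambda>c (p::bipoly). smult [:c:] p)"
    by (simp add: vector_space_pair_def vector_space_bipoly)
  from vector_space_pair.linear_span_image[OF this linear_mult] show ?thesis .
qed

section \<open>Monomials and the dimension of the space of polynomials of bounded degree\<close>

definition monomial :: "nat \<times> nat \<Rightarrow> bipoly" where
  "monomial e = monom (monom 1 (fst e)) (snd e)"

text \<open>The strict inequality makes the zero space available as \<open>exps 0\<close>.\<close>

definition exps :: "nat \<Rightarrow> (nat \<times> nat) set" where
  "exps t = {e. fst e + snd e < t}"

lemma finite_exps [simp]: "finite (exps t)"
  by (rule finite_subset[of _ "{..<t} \<times> {..<t}"]) (auto simp: exps_def)

text \<open>Passing from \<open>t\<close> to \<open>t + 1\<close> adds the diagonal of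
  \<open>t + 1\<close> exponents of sum \<open>t\<close>. The doubled form keeps \<open>div\<close>
  out of later arithmetic.\<close>

lemma double_card_exps: "2 * card (exps t) = t * (t + 1)"
proof (induction t)
  case 0
  then show ?case by (simp add: exps_def)
next
  case (Suc t)
  have "exps (Suc t) = exps t \<union> (\<lambda>i. (i, t - i)) ` {..t}"
    by (force simp: exps_def image_iff)
  moreover have "exps t \<inter> (\<lambda>i. (i, t - i)) ` {..t} = {}" by (auto simp: exps_def)
  moreover have "card ((\<lambda>i. (i, t - i)) ` {..t}) = t + 1"
    by (subst card_image) (auto simp: inj_on_def)
  ultimately have "card (exps (Suc t)) = card (exps t) + (t + 1)"
    by (simp add: card_Un_disjoint)
  then show ?case using Suc by (simp add: algebra_simps)
qed

lemma card_exps: "card (exps (Suc n)) = N n"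
  using double_card_exps[of "Suc n"] by (simp add: N_def)

lemma double_N: "2 * N n = (n + 1) * (n + 2)"
  using double_card_exps[of "Suc n"] by (simp add: card_exps)

lemma coeff_monomial: "coeff (coeff (monomial e) j) i = (if e = (i, j) then 1 else 0)"
  by (cases e) (auto simp: monomial_def)

lemma coeff_sum_monomial:
  assumes "finite E"
  shows "coeff (coeff (\<Sum>e\<in>E. smult [:u e:] (monomial e)) j) i = (if (i, j) \<in> E then u (i, j) else 0)"
proof -
  have "coeff (coeff (\<Sum>e\<in>E. smult [:u e:] (monomial e)) j) i = (\<Sum>e\<in>E. u e * (if e = (i, j) then 1 else 0))"
    by (simp add: coeff_sum coeff_monomial)
  also have "\<dots> = (\<Sum>e\<in>E. if e = (i, j) then u e else 0)"
    by (intro sum.cong) auto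
  finally show ?thesis using assms by (simp add: sum.delta)
qed

lemma independent_monomials: "bipoly.independent (monomial ` exps t)" and
  card_monomials: "card (monomial ` exps t) = card (exps t)"
proof -
  have "bipoly.independent ({} \<union> monomial ` exps t) \<and> card ({} \<union> monomial ` exps t) = card ({}::bipoly set) + card (exps t)"
  proof (rule independent_mod_union)
    fix u e assume "(\<Sum>i\<in>exps t. smult [:u i:] (monomial i)) \<in> bipoly.span {}" and e: "e \<in> exps t"
    then have "(\<Sum>i\<in>exps t. smult [:u i:] (monomial i)) = 0" by simp
    with coeff_sum_monomial[of "exps t" u "snd e" "fst e"] e show "u e = 0" by simp
  qed (auto simp: bipoly.independent_empty)
  then show "bipoly.independent (monomial ` exps t)" "card (monomial ` exps t) = card (exps t)" by auto
qed

lemma span_monomials: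
  "p \<in> bipoly.span (monomial ` exps t) \<longleftrightarrow> (\<forall>i j. coeff (coeff p j) i \<noteq> 0 \<longrightarrow> i + j < t)"
proof
  assume "p \<in> bipoly.span (monomial ` exps t)"
  then show "\<forall>i j. coeff (coeff p j) i \<noteq> 0 \<longrightarrow> i + j < t"
  proof (induction rule: bipoly.span_induct_alt)
    case (step c x y)
    then obtain e where e: "e \<in> exps t" "x = monomial e" by blast
    show ?case
    proof (intro allI impI)
      fix i j assume "coeff (coeff (smult [:c:] x + y) j) i \<noteq> 0"
      then have "e = (i, j) \<or> coeff (coeff y j) i \<noteq> 0"
        by (auto simp: e coeff_monomial split: if_splits)
      with step e show "i + j < t" by (auto simp: exps_def)
    qed
  qed simp
next
  assume *: "\<forall>i j. coeff (coeff p j) i \<noteq> 0 \<longrightarrow> i + j < t"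
  have "p = (\<Sum>e\<in>exps t. smult [:coeff (coeff p (snd e)) (fst e):] (monomial e))"
    using * by (intro poly_eqI, subst coeff_sum_monomial[OF finite_exps]) (auto simp: exps_def)
  also have "\<dots> \<in> bipoly.span (monomial ` exps t)"
    by (intro bipoly.span_sum bipoly.span_scale bipoly.span_base) auto
  finally show "p \<in> bipoly.span (monomial ` exps t)" .
qed

lemma Pi_space_eq_span: "Pi_space n = bipoly.span (monomial ` exps (Suc n))"
  by (auto simp: mem_Pi_space_iff span_monomials less_Suc_eq_le)

lemma subspace_Pi_space: "bipoly.subspace (Pi_space n)"
  unfolding Pi_space_eq_span by (rule bipoly.subspace_span)

lemma Pi_space_mono: "m \<le> n \<Longrightarrow> p \<in> Pi_space m \<Longrightarrow> p \<in> Pi_space n"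
  by (auto simp: Pi_space_def)

section \<open>Total degree of products\<close>

lemma coeff_coeff_mult:
  "coeff (coeff (p * q) J) I
     = (\<Sum>j\<le>J. \<Sum>i\<le>I. coeff (coeff p j) i * coeff (coeff q (J - j)) (I - i))" for p q :: bipoly
  by (simp add: coeff_mult coeff_sum)

lemma Pi_space_mult:
  assumes "p \<in> Pi_space a" "q \<in> Pi_space b"
  shows "p * q \<in> Pi_space (a + b)"
  unfolding mem_Pi_space_iff
proof (intro allI impI)
  fix I J assume "coeff (coeff (p * q) J) I \<noteq> 0"
  then obtain i j where ij: "i \<le> I" "j \<le> J" "coeff (coeff p j) i * coeff (coeff q (J - j)) (I - i) \<noteq> 0"
    unfolding coeff_coeff_mult by (metis (no_types, lifting) atMost_iff sum.neutral)
  then have "coeff (coeff p j) i \<noteq> 0" "coeff (coeff q (J - j)) (I - i) \<noteq> 0" by auto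
  with assms have "i + j \<le> a" "(I - i) + (J - j) \<le> b" unfolding mem_Pi_space_iff by blast+
  with \<open>i \<le> I\<close> \<open>j \<le> J\<close> show "I + J \<le> a + b" by linarith
qed

text \<open>A leading monomial for the order by total degree, ties being decided by the exponent of
  y.\<close>

lemma leading_exponents:
  assumes "p \<noteq> 0"
  obtains i j where "i + j = total_degree p" "coeff (coeff p j) i \<noteq> 0"
    and "\<And>i' j'. coeff (coeff p j') i' \<noteq> 0 \<Longrightarrow> i' + j' < total_degree p \<or> i' + j' = total_degree p \<and> j' \<le> j"
proof -
  let ?S = "{i + j | i j. coeff (coeff p j) i \<noteq> 0}"
  let ?D = "{j. \<exists>i. i + j = total_degree p \<and> coeff (coeff p j) i \<noteq> 0}"
  have "coeff (coeff p (degree p)) (degree (coeff p (degree p))) \<noteq> 0" using assms by simp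
  then have "?S \<noteq> {}" by blast
  \<comment> \<open>As \<open>p\<close> has a nonzero coefficient, the inserted 0 does not change
    the maximum, so the total degree is attained.\<close>
  moreover have "total_degree p = Max ?S"
    unfolding total_degree_def Max_insert[OF finite_exponents calculation] by (rule max_0L)
  ultimately have "total_degree p \<in> ?S" using Max_in[OF finite_exponents[of p]] by presburger
  then obtain i0 j0 where "i0 + j0 = total_degree p" "coeff (coeff p j0) i0 \<noteq> 0" by (smt (verit) mem_Collect_eq)
  then have "?D \<noteq> {}" by blast
  moreover have fin: "finite ?D" by (rule finite_subset[of _ "{..total_degree p}"]) auto
  ultimately have "Max ?D \<in> ?D" using Max_in[of ?D] by blast
  then obtain i where i: "i + Max ?D = total_degree p" "coeff (coeff p (Max ?D)) i \<noteq> 0" by blast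
  have deg: "i' + j' \<le> total_degree p" if "coeff (coeff p j') i' \<noteq> 0" for i' j'
    using mem_Pi_space_iff[of p "total_degree p"] that by (auto simp: Pi_space_def)
  show ?thesis
  proof (rule that[OF i])
    fix i' j' assume c: "coeff (coeff p j') i' \<noteq> 0"
    show "i' + j' < total_degree p \<or> i' + j' = total_degree p \<and> j' \<le> Max ?D"
      using deg[OF c] c Max_ge[OF fin, of j'] by fastforce
  qed
qed

text \<open>Leading coefficients multiply: at the sum of the two leading exponents only the product
  of the two leading terms contributes, and it is nonzero.\<close>

lemma total_degree_mult:
  assumes "p \<noteq> 0" "q \<noteq> 0"
  shows "total_degree (p * q) = total_degree p + total_degree q"
proof (rule antisym)
  show "total_degree (p * q) \<le> total_degree p + total_degree q"
    using Pi_space_mult[of p "total_degree p" q "total_degree q"] by (simp add: Pi_space_def)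
  obtain i0 j0 where p: "i0 + j0 = total_degree p" "coeff (coeff p j0) i0 \<noteq> 0"
    "\<And>i' j'. coeff (coeff p j') i' \<noteq> 0 \<Longrightarrow> i' + j' < total_degree p \<or> i' + j' = total_degree p \<and> j' \<le> j0"
    using leading_exponents[OF assms(1)] by metis
  obtain i1 j1 where q: "i1 + j1 = total_degree q" "coeff (coeff q j1) i1 \<noteq> 0"
    "\<And>i' j'. coeff (coeff q j') i' \<noteq> 0 \<Longrightarrow> i' + j' < total_degree q \<or> i' + j' = total_degree q \<and> j' \<le> j1"
    using leading_exponents[OF assms(2)] by metis
  have "coeff (coeff p j) i * coeff (coeff q (j0 + j1 - j)) (i0 + i1 - i)
      = (if j = j0 \<and> i = i0 then coeff (coeff p j0) i0 * coeff (coeff q j1) i1 else 0)"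
    if "j \<le> j0 + j1" "i \<le> i0 + i1" for i j
  proof (cases "j = j0 \<and> i = i0")
    case True
    then show ?thesis by simp
  next
    case False
    have "\<not> (coeff (coeff p j) i \<noteq> 0 \<and> coeff (coeff q (j0 + j1 - j)) (i0 + i1 - i) \<noteq> 0)"
    proof
      assume "coeff (coeff p j) i \<noteq> 0 \<and> coeff (coeff q (j0 + j1 - j)) (i0 + i1 - i) \<noteq> 0"
      then show False using p(3)[of j i] q(3)[of "j0 + j1 - j" "i0 + i1 - i"] p(1) q(1) that False
        by linarith
    qed
    with False show ?thesis by auto
  qed
  then have "coeff (coeff (p * q) (j0 + j1)) (i0 + i1)
     = (\<Sum>j\<le>j0+j1. \<Sum>i\<le>i0+i1. if j = j0 \<and> i = i0 then coeff (coeff p j0) i0 * coeff (coeff q j1) i1 else 0)"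
    unfolding coeff_coeff_mult by (intro sum.cong refl) auto
  also have "\<dots> = (\<Sum>j\<le>j0+j1. if j = j0 then (\<Sum>i\<le>i0+i1. if i = i0 then coeff (coeff p j0) i0 * coeff (coeff q j1) i1 else 0) else 0)"
    by (intro sum.cong refl) auto
  also have "\<dots> = coeff (coeff p j0) i0 * coeff (coeff q j1) i1"
    by (simp add: sum.delta)
  finally have "coeff (coeff (p * q) (j0 + j1)) (i0 + i1) \<noteq> 0" using p q by simp
  then show "total_degree p + total_degree q \<le> total_degree (p * q)"
    using mem_Pi_space_iff[of "p * q" "total_degree (p * q)"] p(1) q(1) by (fastforce simp: Pi_space_def)
qed

section \<open>Evaluation and polynomials vanishing on nodes\<close>

lemma eval_simps [simp]:
  "eval (p + q) A = eval p A + eval q A" "eval (p - q) A = eval p A - eval q A"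
  "eval (p * q) A = eval p A * eval q A"
  "eval (smult [:c:] p) A = c * eval p A" "eval 0 A = 0" "eval 1 A = 1"
  "eval (sum f S) A = (\<Sum>i\<in>S. eval (f i) A)"
  by (simp_all add: eval_def poly_sum)

text \<open>Fundamental polynomials are independent modulo the polynomials vanishing on
  \<open>Z\<close>: evaluating a relation at a node isolates its coefficient. Together with
  \<open>C\<close> they fit into a space of dimension \<open>N n\<close>.\<close>

lemma independent_vanishing_bound:
  assumes Z: "n_independent n Z" "finite Z"
    and C: "bipoly.independent C" "C \<subseteq> Pi_space n" "\<And>p A. p \<in> C \<Longrightarrow> A \<in> Z \<Longrightarrow> eval p A = 0"
  shows "finite C \<and> card C + card Z \<le> N n"
proof -
  have bound: "finite S \<and> card S \<le> N n" if "bipoly.independent S" "S \<subseteq> Pi_space n" for S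
    using bipoly.independent_span_bound[of "monomial ` exps (Suc n)" S] that
    by (simp add: Pi_space_eq_span card_monomials card_exps)
  have finC: "finite C" using bound C by blast
  obtain f where f: "\<And>A. A \<in> Z \<Longrightarrow> fundamental_polynomial n Z A (f A)"
    using Z(1) unfolding n_independent_def by metis
  have "bipoly.independent (C \<union> f ` Z) \<and> card (C \<union> f ` Z) = card C + card Z"
  proof (rule independent_mod_union[OF Z(2) C(1) finC])
    fix u A assume s: "(\<Sum>A\<in>Z. smult [:u A:] (f A)) \<in> bipoly.span C" and A: "A \<in> Z"
    have "eval p A = 0" if "p \<in> bipoly.span C" for p
      using that by (induction rule: bipoly.span_induct_alt) (auto simp: C(3) A)
    then have "0 = (\<Sum>B\<in>Z. u B * eval (f B) A)" using s by fastforce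
    also have "\<dots> = (\<Sum>B\<in>Z. if B = A then u A else 0)"
      using f A by (intro sum.cong) (auto simp: fundamental_polynomial_def)
    finally show "u A = 0" using A Z(2) by simp
  qed
  moreover have "C \<union> f ` Z \<subseteq> Pi_space n"
    using C(2) f by (auto simp: fundamental_polynomial_def)
  ultimately show ?thesis using bound finC by metis
qed

lemma n_independent_subset: "n_independent n X \<Longrightarrow> Y \<subseteq> X \<Longrightarrow> n_independent n Y"
  unfolding n_independent_def fundamental_polynomial_def by blast

text \<open>The space written $I_n$ in the overview.\<close>

definition vanishing :: "nat \<Rightarrow> (real \<times> real) set \<Rightarrow> bipoly set" where
  "vanishing n X = {p \<in> Pi_space n. \<forall>A\<in>X. eval p A = 0}"

lemma subspace_vanishing: "bipoly.subspace (vanishing n X)"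
  using subspace_Pi_space[of n] unfolding vanishing_def bipoly.subspace_def by auto

lemma vanishing_mult: "p \<in> vanishing m X \<Longrightarrow> q \<in> Pi_space n \<Longrightarrow> p * q \<in> vanishing (m + n) X"
  by (simp add: vanishing_def Pi_space_mult)

section \<open>Growth of the number of independent top forms\<close>

lemma coeff_x_mult: "coeff (coeff ([:[:0, 1:]:] * p) j) i = (if i = 0 then 0 else coeff (coeff p j) (i - 1))"
  for p :: bipoly
  by (cases i) simp_all

lemma coeff_y_mult: "coeff (coeff ([:0, 1:] * p) j) i = (if j = 0 then 0 else coeff (coeff p (j - 1)) i)"
  for p :: bipoly
  by (cases j) simp_all

lemma linear_x_in_Pi_space: "[:[:a, b:]:] \<in> Pi_space 1" and linear_in_Pi_space: "[:[:a, b:], [:c:]:] \<in> Pi_space 1"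
  by (auto simp: mem_Pi_space_iff coeff_pCons split: nat.splits)

text \<open>All the \<open>c i\<close> are multiplied by $x$, and one whose top form has the largest
  $y$-exponent is also multiplied by $y$; its new leading monomial occurs in none of the others.\<close>

lemma growth_step:
  fixes c :: "nat \<Rightarrow> bipoly"
  assumes c: "\<And>i. i < w \<Longrightarrow> c i \<in> vanishing (Suc e) X"
    and ind: "\<And>u i. \<lbrakk>(\<Sum>i<w. smult [:u i:] (c i)) \<in> Pi_space e; i < w\<rbrakk> \<Longrightarrow> u i = 0"
    and w: "0 < w"
  obtains c' where "\<And>i. i < Suc w \<Longrightarrow> c' i \<in> vanishing (Suc (Suc e)) X"
    and "\<And>u i. \<lbrakk>(\<Sum>i<Suc w. smult [:u i:] (c' i)) \<in> Pi_space (Suc e); i < Suc w\<rbrakk> \<Longrightarrow> u i = 0"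
proof -
  \<comment> \<open>The exponents of y that occur in the top forms, that is, in the parts of degree
    \<open>Suc e\<close>, of the \<open>c i\<close>.\<close>
  let ?D = "{Y. Y \<le> Suc e \<and> (\<exists>i<w. coeff (coeff (c i) Y) (Suc e - Y) \<noteq> 0)}"
  have fin: "finite ?D" by (rule finite_subset[of _ "{..Suc e}"]) auto
  have "c 0 \<notin> Pi_space e"
  proof
    assume *: "c 0 \<in> Pi_space e"
    have "(\<Sum>i<w. smult [:if i = 0 then 1 else 0:] (c i)) = (\<Sum>i<w. if i = 0 then c 0 else 0)"
      by (intro sum.cong) (auto simp flip: one_pCons)
    also have "\<dots> = c 0" using w by simp
    finally show False using * ind[of "\<lambda>i. if i = 0 then 1 else 0" 0] w by simp
  qed
  then obtain i j where ij: "coeff (coeff (c 0) j) i \<noteq> 0" "\<not> i + j \<le> e"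
    by (auto simp: mem_Pi_space_iff)
  moreover have "i + j \<le> Suc e" using c[OF w] ij(1) by (auto simp: vanishing_def mem_Pi_space_iff)
  ultimately have "i = Suc e - j" "j \<le> Suc e" by linarith+
  then have "j \<in> ?D" using ij w by auto
  then have "Max ?D \<in> ?D" using Max_in[OF fin] by blast
  then obtain l where l: "Max ?D \<le> Suc e" "l < w" "coeff (coeff (c l) (Max ?D)) (Suc e - Max ?D) \<noteq> 0"
    by blast
  define Y where "Y = Max ?D"
  have Y: "Y \<le> Suc e" "coeff (coeff (c l) Y) (Suc e - Y) \<noteq> 0" using l by (auto simp: Y_def)
  have Ymax: "coeff (coeff (c i) (Suc Y)) (e - Y) = 0" if "i < w" "Y \<le> e" for i
  proof (rule ccontr)
    assume "coeff (coeff (c i) (Suc Y)) (e - Y) \<noteq> 0"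
    then have "Suc Y \<in> ?D" using that by auto
    from Max_ge[OF fin this] show False by (simp add: Y_def)
  qed
  define x :: bipoly where "x = [:[:0, 1:]:]"
  define y :: bipoly where "y = [:0, 1:]"
  note coeff_x = coeff_x_mult[folded x_def] and coeff_y = coeff_y_mult[folded y_def]
  have x: "x \<in> Pi_space 1" using linear_x_in_Pi_space by (simp add: x_def)
  have y: "y \<in> Pi_space 1" using linear_in_Pi_space[of 0 0 1] by (simp add: one_pCons y_def)
  define c' where "c' = (\<lambda>i. if i < w then x * c i else y * c l)"
  show ?thesis
  proof (rule that)
    fix i
    show "c' i \<in> vanishing (Suc (Suc e)) X"
      using vanishing_mult[OF c x] vanishing_mult[OF c y] l(2)
      by (simp add: c'_def mult.commute)
  next
    fix u :: "nat \<Rightarrow> real" and i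
    let ?S = "\<Sum>i<w. smult [:u i:] (c i)"
    assume "(\<Sum>i<Suc w. smult [:u i:] (c' i)) \<in> Pi_space (Suc e)" and i: "i < Suc w"
    moreover have "(\<Sum>i<Suc w. smult [:u i:] (c' i)) = x * ?S + smult [:u w:] (y * c l)"
      by (simp add: c'_def sum_distrib_left)
    ultimately have mem: "x * ?S + smult [:u w:] (y * c l) \<in> Pi_space (Suc e)" by simp
    have "coeff (coeff ?S (Suc Y)) (e - Y) = 0" if "Y \<le> e"
      using Ymax that by (simp add: coeff_sum)
    \<comment> \<open>For \<open>Y \<le> e\<close> this is the maximality of \<open>Y\<close>; for
      \<open>Y = Suc e\<close> the monomial is a pure power of y, which no multiple of x
      contains.\<close>
    then have "coeff (coeff (x * ?S) (Suc Y)) (Suc e - Y) = 0"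
      unfolding coeff_x by (auto simp: Suc_diff_le)
    \<comment> \<open>The monomial has degree \<open>e + 2\<close>, too large for
      \<open>Pi_space (Suc e)\<close>.\<close>
    moreover have "coeff (coeff (x * ?S + smult [:u w:] (y * c l)) (Suc Y)) (Suc e - Y) = 0"
    proof (rule ccontr)
      assume "\<not> ?thesis"
      then have "Suc e - Y + Suc Y \<le> Suc e" using mem unfolding mem_Pi_space_iff by blast
      with Y(1) show False by linarith
    qed
    ultimately have "u w * coeff (coeff (y * c l) (Suc Y)) (Suc e - Y) = 0" by simp
    then have uw: "u w = 0" using Y(2) unfolding coeff_y by simp
    \<comment> \<open>With \<open>u w = 0\<close> the relation is a multiple of x, and cancelling x
      lowers the degree by one, so that \<open>ind\<close> applies.\<close>
    have "?S \<in> Pi_space e"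
      unfolding mem_Pi_space_iff
    proof (intro allI impI)
      fix i j assume "coeff (coeff ?S j) i \<noteq> 0"
      then have "coeff (coeff (x * ?S) j) (Suc i) \<noteq> 0" unfolding coeff_x by simp
      moreover have "x * ?S \<in> Pi_space (Suc e)" using mem uw by simp
      ultimately have "Suc i + j \<le> Suc e" unfolding mem_Pi_space_iff by blast
      then show "i + j \<le> e" by simp
    qed
    then show "u i = 0" using ind[of u i] uw i by (cases "i = w") auto
  qed
qed

text \<open>Since \<open>vanishing e X\<close> is zero, \<open>S\<close> is independent modulo
  polynomials of degree \<open>e\<close>. By \<open>growth_step\<close>, each further degree
  contributes a layer with one more polynomial than the last, independent modulo everything of lower
  degree.\<close>

lemma vanishing_growth:
  assumes zero: "vanishing e X = {0}"
    and S: "bipoly.independent S" "S \<subseteq> vanishing (Suc e) X" "finite S" "card S = w" "0 < w"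
  shows "\<exists>B. bipoly.independent B \<and> B \<subseteq> vanishing (Suc (e + m)) X \<and> card B = (\<Sum>i\<le>m. w + i)"
proof -
  \<comment> \<open>The induction carries the newest layer \<open>c\<close> beside the union
    \<open>B\<close> of all layers: the next growth step needs a family independent modulo lower
    degree.\<close>
  let ?P = "\<lambda>m c. (\<forall>i<w + m. c i \<in> vanishing (Suc (e + m)) X)
      \<and> (\<forall>u. (\<Sum>i<w + m. smult [:u i:] (c i)) \<in> Pi_space (e + m) \<longrightarrow> (\<forall>i<w + m. u i = 0))"
  have "\<exists>B c. bipoly.independent B \<and> finite B \<and> B \<subseteq> vanishing (Suc (e + m)) X
    \<and> card B = (\<Sum>i\<le>m. w + i) \<and> ?P m c"
  proof (induction m)
    case 0
    obtain c where c: "bij_betw c {..<w} S"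
      using S(3,4) by (metis ex_bij_betw_nat_finite lessThan_atLeast0)
    have cS: "c i \<in> S" if "i < w" for i using c that by (auto simp: bij_betw_def)
    have ind: "u i = 0" if s: "(\<Sum>i<w. smult [:u i:] (c i)) \<in> Pi_space e" and i: "i < w" for u i
    proof -
      have "(\<Sum>i<w. smult [:u i:] (c i)) \<in> vanishing (Suc e) X"
        by (rule bipoly.subspace_sum[OF subspace_vanishing], rule bipoly.subspace_scale[OF subspace_vanishing])
          (use S(2) cS in auto)
      then have "(\<Sum>i<w. smult [:u i:] (c i)) \<in> vanishing e X"
        using s by (simp add: vanishing_def)
      then have 0: "(\<Sum>i<w. smult [:u i:] (c i)) = 0" using zero by simp
      \<comment> \<open>Turns coefficients by index into coefficients by element of
        \<open>S\<close>, as \<open>independentD\<close> requires.\<close>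
      let ?v = "\<lambda>p. u (the_inv_into {..<w} c p)"
      have inv: "the_inv_into {..<w} c (c i) = i" if "i < w" for i
        using c that by (simp add: bij_betw_def the_inv_into_f_f)
      have "(\<Sum>p\<in>S. smult [:?v p:] p) = (\<Sum>i<w. smult [:?v (c i):] (c i))"
        by (rule sum.reindex_bij_betw[OF c, symmetric])
      also have "\<dots> = (\<Sum>i<w. smult [:u i:] (c i))"
        by (rule sum.cong) (simp_all add: inv)
      finally have "(\<Sum>p\<in>S. smult [:?v p:] p) = 0" using 0 by simp
      then have "?v (c i) = 0"
        by (rule bipoly.independentD[OF S(1,3) order_refl _ cS[OF i]])
      then show ?thesis using inv[OF i] by simp
    qed
    have "?P 0 c"
    proof (intro conjI allI impI)
      fix i assume "i < w + 0"
      then show "c i \<in> vanishing (Suc (e + 0)) X" using cS[of i] S(2) by auto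
    next
      fix u i assume "(\<Sum>i<w + 0. smult [:u i:] (c i)) \<in> Pi_space (e + 0)" "i < w + 0"
      then show "u i = 0" using ind[of u i] by simp
    qed
    moreover have "card S = (\<Sum>i\<le>0. w + i)" using S(4) by simp
    moreover have "S \<subseteq> vanishing (Suc (e + 0)) X" using S(2) by simp
    ultimately show ?case using S(1,3) by blast
  next
    case (Suc m)
    then obtain B c where B: "bipoly.independent B" "finite B" "B \<subseteq> vanishing (Suc (e + m)) X"
      "card B = (\<Sum>i\<le>m. w + i)" and P: "?P m c" by blast
    obtain c' where c': "\<And>i. i < Suc (w + m) \<Longrightarrow> c' i \<in> vanishing (Suc (Suc (e + m))) X"
      "\<And>u i. \<lbrakk>(\<Sum>i<Suc (w + m). smult [:u i:] (c' i)) \<in> Pi_space (Suc (e + m)); i < Suc (w + m)\<rbrakk> \<Longrightarrow> u i = 0"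
    proof (rule growth_step)
      show "c i \<in> vanishing (Suc (e + m)) X" if "i < w + m" for i using P that by blast
      show "u i = 0" if "(\<Sum>i<w + m. smult [:u i:] (c i)) \<in> Pi_space (e + m)" "i < w + m" for u i
        using P that by blast
    qed (use S(5) in auto)
    \<comment> \<open>All earlier layers lie in this space, modulo which the new layer
      \<open>c'\<close> is independent.\<close>
    have span: "bipoly.span B \<subseteq> Pi_space (Suc (e + m))"
      using B(3) subspace_Pi_space by (intro bipoly.span_minimal) (auto simp: vanishing_def)
    let ?B = "B \<union> c' ` {..<Suc (w + m)}"
    have ind: "bipoly.independent ?B \<and> card ?B = card B + card {..<Suc (w + m)}"
      using c'(2) span by (intro independent_mod_union B finite_lessThan) blast
    have "?B \<subseteq> vanishing (Suc (e + Suc m)) X"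
      using B(3) c'(1) Pi_space_mono[of "Suc (e + m)" "Suc (Suc (e + m))"]
      by (auto simp: vanishing_def)
    moreover have "?P (Suc m) c'"
    proof (intro conjI allI impI)
      fix i assume "i < w + Suc m"
      then show "c' i \<in> vanishing (Suc (e + Suc m)) X" using c'(1)[of i] by simp
    next
      fix u i assume "(\<Sum>i<w + Suc m. smult [:u i:] (c' i)) \<in> Pi_space (e + Suc m)" "i < w + Suc m"
      then show "u i = 0" using c'(2)[of u i] by simp
    qed
    moreover have "finite ?B" using B(2) by simp
    moreover have "card ?B = (\<Sum>i\<le>Suc m. w + i)" using B(4) ind by simp
    ultimately show ?case using conjunct1[OF ind] by blast
  qed
  then show ?thesis by blast
qed

section \<open>Bounds on numbers of nodes and common zeros\<close>

text \<open>For each other node \<open>B\<close> take the line through \<open>B\<close>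
  perpendicular to AB; it misses \<open>A\<close>. The product over these at most \<open>n\<close>
  nodes is, up to a scalar, a fundamental polynomial of \<open>A\<close>.\<close>

lemma n_independent_few_points:
  assumes "finite Z" "card Z \<le> Suc n"
  shows "n_independent n Z"
  unfolding n_independent_def
proof
  fix A assume A: "A \<in> Z"
  define l :: "real \<times> real \<Rightarrow> bipoly" where "l = (\<lambda>B.
    [:[:- (fst A - fst B) * fst B - (snd A - snd B) * snd B, fst A - fst B:], [:snd A - snd B:]:])"
  have l: "eval (l B) C = (fst A - fst B) * (fst C - fst B) + (snd A - snd B) * (snd C - snd B)" for B C
    by (simp add: l_def eval_def algebra_simps)
  have l1: "l B \<in> Pi_space 1" for B unfolding l_def by (rule linear_in_Pi_space)
  have "prod l F \<in> Pi_space (card F) \<and> (\<forall>C. eval (prod l F) C = (\<Prod>B\<in>F. eval (l B) C))" if "finite F" for F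
    using that
  proof induction
    case empty
    have "(1::bipoly) \<in> Pi_space 0" by (auto simp: mem_Pi_space_iff coeff_pCons one_pCons split: nat.splits if_splits)
    then show ?case by simp
  next
    case (insert B F)
    then show ?case using Pi_space_mult[of "l B" 1 "prod l F" "card F"] l1 by simp
  qed
  from this[of "Z - {A}"] assms(1) have p: "prod l (Z - {A}) \<in> Pi_space (card (Z - {A}))"
    "\<And>C. eval (prod l (Z - {A})) C = (\<Prod>B\<in>Z - {A}. eval (l B) C)" by auto
  have "card (Z - {A}) \<le> n" using assms A by simp
  with p have pn: "prod l (Z - {A}) \<in> Pi_space n" using Pi_space_mono by blast
  have "eval (l B) A \<noteq> 0" if "B \<noteq> A" for B
    using that unfolding l by (auto simp: sum_squares_eq_zero_iff prod_eq_iff)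
  then have nz: "eval (prod l (Z - {A})) A \<noteq> 0" unfolding p using assms by auto
  have "eval (prod l (Z - {A})) B = 0" if "B \<in> Z - {A}" for B
    unfolding p using that assms by (auto simp: prod_zero_iff l intro!: bexI[of _ B])
  then have "fundamental_polynomial n Z A (smult [:1 / eval (prod l (Z - {A})) A:] (prod l (Z - {A})))"
    using nz pn bipoly.subspace_scale[OF subspace_Pi_space] by (simp add: fundamental_polynomial_def)
  then show "\<exists>p. fundamental_polynomial n Z A p" ..
qed

lemma N_le_iff: "N a \<le> N b \<longleftrightarrow> a \<le> b"
proof -
  have "N a \<le> N b" if "a \<le> b" for a b
    using mult_le_mono[of "a + 1" "b + 1" "a + 2" "b + 2"] that double_N[of a] double_N[of b] by linarith
  moreover have "N a < N (Suc a)" for a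
    using double_N[of a] double_N[of "Suc a"] by simp
  ultimately show ?thesis by (metis Suc_leI leD leI le_trans)
qed

lemma vanishing_bound:
  assumes "n_independent n X" "finite X" "bipoly.independent C" "C \<subseteq> vanishing n X"
  shows "card C + card X \<le> N n"
  using independent_vanishing_bound[of n X C] assms by (auto simp: vanishing_def)

text \<open>The polynomials $r, xr, yr, s$ are independent, while three points would cut the
  six-dimensional $\Pi_2$ down to dimension three.\<close>

lemma common_zeros_le_2:
  assumes "r \<in> Pi_space 1" "s \<in> Pi_space 2" "r \<noteq> 0" and s: "s \<notin> (*) r ` Pi_space 1"
    and "finite Z" and Z: "\<And>A. A \<in> Z \<Longrightarrow> eval r A = 0 \<and> eval s A = 0"
  shows "card Z \<le> 2"
proof (rule ccontr)
  assume "\<not> card Z \<le> 2"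
  then obtain Y where Y: "Y \<subseteq> Z" "card Y = 3" "finite Y"
    using obtain_subset_with_card_n[of 3 Z] by auto
  let ?B = "(*) r ` (monomial ` exps 2)"
  have e2: "exps 2 = exps (Suc 1)" by (simp add: numeral_2_eq_2)
  have sB: "s \<notin> bipoly.span ?B"
    unfolding span_mult_image e2 Pi_space_eq_span[symmetric] by (rule s)
  have ind: "bipoly.independent ?B"
    by (intro independent_mult_image independent_monomials assms)
  have "card ?B = 3"
    using double_card_exps[of 2] by (simp add: card_mult_image[OF assms(3)] card_monomials)
  moreover have "s \<notin> ?B" using sB bipoly.span_base[of s ?B] by argo
  ultimately have card: "card (insert s ?B) = 4" by simp
  have "?B \<subseteq> Pi_space 2"
    using Pi_space_mult[OF assms(1), of _ 1] bipoly.span_base[of _ "monomial ` exps 2"]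
    unfolding e2 Pi_space_eq_span[symmetric] by (auto simp: numeral_2_eq_2)
  then have "insert s ?B \<subseteq> vanishing 2 Y"
    using assms(2) Z Y(1) by (auto simp: vanishing_def)
  moreover have "n_independent 2 Y" using Y by (intro n_independent_few_points) auto
  ultimately have "card (insert s ?B) + card Y \<le> N 2"
    using bipoly.independent_insertI[OF sB ind] Y(3) by (intro vanishing_bound)
  then show False using card Y(2) by (simp add: N_def)
qed

text \<open>The multiples of \<open>g\<close> by polynomials of degree at most
  \<open>n - total_degree g\<close> vanish on the nodes on \<open>g\<close> and form a space of
  dimension \<open>N (n - total_degree g)\<close>; the remaining dimensions bound the number of
  nodes.\<close>

lemma card_nodes_on_le:
  assumes "n_independent n X" "finite X" "g \<noteq> 0" "total_degree g \<le> n"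
  shows "card (nodes_on g X) \<le> d n (total_degree g)"
proof -
  let ?e = "total_degree g"
  let ?B = "(*) g ` (monomial ` exps (Suc (n - ?e)))"
  have "monomial ` exps (Suc (n - ?e)) \<subseteq> Pi_space (n - ?e)"
    unfolding Pi_space_eq_span by (auto intro: bipoly.span_base)
  then have "?B \<subseteq> vanishing n (nodes_on g X)"
    using Pi_space_mult[of g ?e _ "n - ?e"] assms(4)
    by (auto simp: vanishing_def nodes_on_def Pi_space_def image_subset_iff)
  moreover have "bipoly.independent ?B"
    by (intro independent_mult_image independent_monomials assms)
  moreover have "n_independent n (nodes_on g X)"
    by (rule n_independent_subset[OF assms(1)]) (auto simp: nodes_on_def)
  moreover have "finite (nodes_on g X)" using assms(2) by (auto simp: nodes_on_def)
  ultimately have "card ?B + card (nodes_on g X) \<le> N n" by (intro vanishing_bound)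
  then show ?thesis
    by (simp add: card_mult_image[OF assms(3)] card_monomials card_exps d_def)
qed

section \<open>Syzygies and the curve of degree \<open>k - 2\<close>\<close>

text \<open>If all syzygies came from $b$ of degree below $m - 1$, then $K$ would be so small that
  $r \Pi_{m+1} + s \Pi_m$ outgrows the polynomials of degree $n$ vanishing on $X$.\<close>

lemma large_syzygy:
  assumes X: "n_independent n X" "finite X" "card X + N (m + 2) = N n + 2"
    and n: "n = Suc e + m" and m: "0 < m"
    and r: "r \<in> vanishing e X" "r \<noteq> 0" and s: "s \<in> vanishing (Suc e) X" "s \<noteq> 0"
    and g: "r = g * r'" "s = g * s'" "coprime r' s'"
  obtains b where "b \<noteq> 0" "r' * b \<in> Pi_space m" "s' * b \<in> Pi_space (m + 1)" "m \<le> Suc (total_degree b)"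
proof (rule ccontr)
  assume no: "\<not> thesis"
  \<comment> \<open>The kernel of multiplication by \<open>s\<close> from \<open>Pi_space m\<close>
    into the polynomials modulo \<open>r * Pi_space (m + 1)\<close>.\<close>
  define K where "K = {b \<in> Pi_space m. \<exists>a\<in>Pi_space (m + 1). s * b = r * a}"
  have "K \<subseteq> bipoly.span ((*) r' ` (monomial ` exps (m - 1)))"
  proof
    fix b assume "b \<in> K"
    then obtain a where b: "b \<in> Pi_space m" and a: "a \<in> Pi_space (m + 1)" "s * b = r * a"
      by (auto simp: K_def)
    from a(2) have eq: "s' * b = r' * a" using r(2) by (auto simp: g(1,2) mult.assoc)
    then have "r' dvd s' * b" by simp
    \<comment> \<open>By coprimality every syzygy is a multiple of the basic one:
      \<open>b = r' * b'\<close> and \<open>a = s' * b'\<close>.\<close>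
    then have "r' dvd b" using g(3) by (simp add: coprime_dvd_mult_right_iff)
    then obtain b' where b': "b = r' * b'" by blast
    with eq have a': "a = s' * b'" using r(2) g(1) by (auto simp: algebra_simps)
    \<comment> \<open>Otherwise \<open>b'\<close> would be the required polynomial. For
      \<open>m = 1\<close> only \<open>b' = 0\<close> remains, matching the empty set
      \<open>exps 0\<close>.\<close>
    have "b' = 0 \<or> total_degree b' < m - 1"
      using no that[of b'] b a(1) m unfolding b' a' by (metis One_nat_def Suc_pred not_less not_less_eq)
    then have "b' \<in> bipoly.span (monomial ` exps (m - 1))"
    proof
      assume "total_degree b' < m - 1"
      then show ?thesis
        using mem_Pi_space_iff[of b' "total_degree b'"]
        by (fastforce simp: span_monomials Pi_space_def)
    qed (simp add: bipoly.span_zero)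
    then show "b \<in> bipoly.span ((*) r' ` (monomial ` exps (m - 1)))"
      unfolding span_mult_image b' by (rule imageI)
  qed
  moreover obtain \<beta> where \<beta>: "\<beta> \<subseteq> K" "bipoly.independent \<beta>" "K \<subseteq> bipoly.span \<beta>"
    using bipoly.maximal_independent_subset by blast
  ultimately have "card \<beta> \<le> card ((*) r' ` (monomial ` exps (m - 1)))"
    using bipoly.independent_span_bound[of "(*) r' ` (monomial ` exps (m - 1))" \<beta>] by auto
  also have "\<dots> \<le> card (exps (m - 1))"
    by (metis card_image_le card_monomials finite_exps finite_imageI)
  finally have card_\<beta>: "card \<beta> \<le> card (exps (m - 1))" .
  have "\<beta> \<subseteq> Pi_space m" using \<beta>(1) by (auto simp: K_def)
  \<comment> \<open>Extending the basis \<open>\<beta>\<close> of the kernel,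
    \<open>B - \<beta>\<close> spans a complement on which multiplication by \<open>s\<close> is
    injective modulo \<open>r * Pi_space (m + 1)\<close>.\<close>
  then obtain B where B: "\<beta> \<subseteq> B" "B \<subseteq> Pi_space m" "bipoly.independent B" "Pi_space m \<subseteq> bipoly.span B"
    using bipoly.maximal_independent_subset_extend[OF _ \<beta>(2)] by metis
  have finB: "finite B"
    using bipoly.independent_span_bound[of "monomial ` exps (Suc m)" B] B by (simp add: Pi_space_eq_span)
  have "monomial ` exps (Suc m) \<subseteq> bipoly.span B"
    using B(4) bipoly.span_base unfolding Pi_space_eq_span by blast
  then have "card (monomial ` exps (Suc m)) \<le> card B"
    using bipoly.independent_span_bound[OF finB independent_monomials] by blast
  then have card_B: "N m \<le> card B" by (simp add: card_monomials card_exps)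
  let ?\<gamma> = "B - \<beta>"
  let ?R = "(*) r ` (monomial ` exps (Suc (m + 1)))"
  have "bipoly.independent (?R \<union> (*) s ` ?\<gamma>) \<and> card (?R \<union> (*) s ` ?\<gamma>) = card ?R + card ?\<gamma>"
  proof (rule independent_mod_union)
    fix u b assume b: "b \<in> ?\<gamma>" and "(\<Sum>b\<in>?\<gamma>. smult [:u b:] (s * b)) \<in> bipoly.span ?R"
    then obtain a where "a \<in> Pi_space (m + 1)" "(\<Sum>b\<in>?\<gamma>. smult [:u b:] (s * b)) = r * a"
      unfolding span_mult_image Pi_space_eq_span[symmetric] by blast
    moreover have "(\<Sum>b\<in>?\<gamma>. smult [:u b:] (s * b)) = s * (\<Sum>b\<in>?\<gamma>. smult [:u b:] b)"
      by (simp add: sum_distrib_left)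
    moreover have "(\<Sum>b\<in>?\<gamma>. smult [:u b:] b) \<in> Pi_space m"
      by (rule bipoly.subspace_sum[OF subspace_Pi_space], rule bipoly.subspace_scale[OF subspace_Pi_space])
        (use B(2) in auto)
    ultimately have "(\<Sum>b\<in>?\<gamma>. smult [:u b:] b) \<in> bipoly.span \<beta>"
      using \<beta>(3) by (auto simp: K_def)
    then obtain v where v: "(\<Sum>b\<in>?\<gamma>. smult [:u b:] b) = (\<Sum>b\<in>\<beta>. smult [:v b:] b)"
      using bipoly.span_finite[of \<beta>] finite_subset[OF B(1) finB] by auto
    let ?w = "\<lambda>b. if b \<in> \<beta> then - v b else u b"
    have "(\<Sum>b\<in>B. smult [:?w b:] b) = (\<Sum>b\<in>?\<gamma>. smult [:?w b:] b) + (\<Sum>b\<in>\<beta>. smult [:?w b:] b)"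
      using sum.subset_diff[OF B(1) finB] by blast
    also have "(\<Sum>b\<in>?\<gamma>. smult [:?w b:] b) = (\<Sum>b\<in>?\<gamma>. smult [:u b:] b)"
      by (rule sum.cong) auto
    also have "(\<Sum>b\<in>\<beta>. smult [:?w b:] b) = (\<Sum>b\<in>\<beta>. - smult [:v b:] b)"
      by (rule sum.cong) (simp_all only: bipoly.scale_minus_left if_True refl)
    also have "\<dots> = - (\<Sum>b\<in>\<beta>. smult [:v b:] b)" by (rule sum_negf)
    finally have "(\<Sum>b\<in>B. smult [:?w b:] b) = 0" by (simp only: v right_minus)
    then have "?w b = 0"
      by (rule bipoly.independentD[OF B(3) finB order_refl]) (use b in auto)
    then show "u b = 0" using b by simp
  qed (simp_all add: finB independent_mult_image[OF independent_monomials r(2)] del: image_image)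
  moreover have "?R \<union> (*) s ` ?\<gamma> \<subseteq> vanishing n X"
  proof -
    have "monomial ` exps (Suc (m + 1)) \<subseteq> Pi_space (m + 1)"
      unfolding Pi_space_eq_span by (auto intro: bipoly.span_base)
    then have "?R \<subseteq> vanishing (e + (m + 1)) X"
      using vanishing_mult[OF r(1)] by blast
    moreover have "(*) s ` ?\<gamma> \<subseteq> vanishing (Suc e + m) X"
      using vanishing_mult[OF s(1)] B(2) by blast
    ultimately show ?thesis by (simp add: n)
  qed
  ultimately have "card ?R + card ?\<gamma> + card X \<le> N n"
    using vanishing_bound[OF X(1,2)] by metis
  moreover have "card ?R = N (m + 1)"
    by (simp only: card_mult_image[OF r(2)] card_monomials card_exps)
  moreover have "card ?\<gamma> = card B - card \<beta>"
    using B(1) finB by (simp add: card_Diff_subset finite_subset)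
  ultimately have "N (m + 1) + N m + 2 \<le> N (m + 2) + card (exps (m - 1))"
    using card_\<beta> card_B X(3) by linarith
  \<comment> \<open>Once expanded, the left side exceeds the right side by \<open>2 * m\<close>,
    contradicting \<open>0 < m\<close>.\<close>
  then have "2 * N (m + 1) + 2 * N m + 4 \<le> 2 * N (m + 2) + 2 * card (exps (m - 1))" by linarith
  moreover obtain l where "m = Suc l" using m gr0_implies_Suc by blast
  ultimately show False unfolding double_N double_card_exps by simp
qed

text \<open>Without such an \<open>r\<close>, four independent polynomials would grow to 4 + 5 + ...
  + (m + 4) independent ones in \<open>vanishing n X\<close>, whose dimension is at most
  \<open>N (m + 2) - 2\<close>; this is too many by \<open>m\<close>.\<close>

lemma exists_lower_degree:
  assumes X: "n_independent n X" "finite X" "card X + N (m + 2) = N n + 2"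
    and n: "n = Suc e + m" and m: "0 < m"
    and S: "bipoly.independent S" "S \<subseteq> vanishing (Suc e) X" "card S = 4"
  obtains r where "r \<in> vanishing e X" "r \<noteq> 0"
proof (rule ccontr)
  assume "\<not> thesis"
  then have "vanishing e X = {0}"
    using that bipoly.subspace_0[OF subspace_vanishing] by blast
  from vanishing_growth[OF this S(1,2) _ S(3), of m] S(3)
  obtain B where B: "bipoly.independent B" "B \<subseteq> vanishing (Suc (e + m)) X" "card B = (\<Sum>i\<le>m. 4 + i)"
    using card.infinite by fastforce
  have "card B + card X \<le> N n"
    using vanishing_bound[OF X(1,2) B(1)] B(2) n by simp
  moreover have "2 * (\<Sum>i\<le>m. 4 + i) = (m + 1) * (m + 8)" by (induction m) (simp_all add: algebra_simps)
  ultimately have "(m + 1) * (m + 8) + 4 \<le> 2 * N (m + 2)" using X(3) B(3) by linarith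
  then show False using m unfolding double_N by (simp add: algebra_simps)
qed

lemma maximal_curve_if_four_curves:
  assumes "3 \<le> k" "k \<le> n - 1" and X: "finite X" "n_independent n X" "card X = d n (k - 2) + 2"
    and S: "bipoly.independent S" "S \<subseteq> vanishing k X" "card S = 4"
  shows "\<exists>q. maximal_curve n X (k - 2) q \<and> card (X - nodes_on q X) = 2"
proof -
  define e where "e = k - 1"
  define m where "m = n - k"
  have k: "k = Suc e" "2 \<le> e" and n: "n = Suc e + m" and m: "0 < m" and nk: "n - (k - 2) = m + 2"
    using assms(1,2) by (auto simp: e_def m_def)
  have "N (m + 2) \<le> N n" using nk by (simp add: N_le_iff)
  then have cX: "card X + N (m + 2) = N n + 2" using X(3) by (simp add: d_def nk)
  obtain r where r: "r \<in> vanishing e X" "r \<noteq> 0"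
    using exists_lower_degree[OF X(2,1) cX n m] S k(1) by metis
  have Pi1: "Pi_space 1 = bipoly.span (monomial ` exps 2)"
    unfolding Pi_space_eq_span by (simp add: numeral_2_eq_2)
  \<comment> \<open>The span is \<open>r * Pi_space 1\<close>, of dimension 3, too small for the
    four independent members of \<open>S\<close>.\<close>
  have "\<not> S \<subseteq> bipoly.span ((*) r ` (monomial ` exps 2))"
  proof
    assume "S \<subseteq> bipoly.span ((*) r ` (monomial ` exps 2))"
    then have "card S \<le> card ((*) r ` (monomial ` exps 2))"
      using bipoly.independent_span_bound[OF _ S(1)] by auto
    then show False
      using double_card_exps[of 2] S(3) by (simp add: card_mult_image[OF r(2)] card_monomials)
  qed
  then obtain s where sS: "s \<in> S" and s_not: "s \<notin> (*) r ` Pi_space 1"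
    unfolding span_mult_image Pi1 by blast
  have s: "s \<in> vanishing (Suc e) X" using sS S(2) k(1) by blast
  have "0 \<in> Pi_space 1" by (rule bipoly.subspace_0[OF subspace_Pi_space])
  with s_not have s0: "s \<noteq> 0" by force
  \<comment> \<open>The greatest common divisor turns out to be the maximal curve.\<close>
  define g where "g = gcd r s"
  have g0: "g \<noteq> 0" using r(2) by (simp add: g_def)
  then obtain r' s' where g: "r = g * r'" "s = g * s'" "coprime r' s'"
    using gcd_coprime_exists[of r s] unfolding g_def by (metis mult.commute)
  have r'0: "r' \<noteq> 0" and s'0: "s' \<noteq> 0" using r(2) s0 g by auto
  obtain b where b: "b \<noteq> 0" "r' * b \<in> Pi_space m" "s' * b \<in> Pi_space (m + 1)" "m \<le> Suc (total_degree b)"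
    using large_syzygy[OF X(2,1) cX n m r s s0 g] by blast
  \<comment> \<open>Since \<open>b\<close> has degree at least \<open>m - 1\<close>, at most degree
    1 is left for \<open>r'\<close> and degree 2 for \<open>s'\<close>.\<close>
  have r'_deg: "total_degree r' \<le> 1" and s'_deg: "total_degree s' \<le> 2"
    using b total_degree_mult[OF r'0 b(1)] total_degree_mult[OF s'0 b(1)]
    by (auto simp: Pi_space_def)
  have r_deg: "total_degree g + total_degree r' \<le> e" and s_deg: "total_degree g + total_degree s' \<le> Suc e"
    using r(1) s total_degree_mult[OF g0 r'0] total_degree_mult[OF g0 s'0]
    by (auto simp: vanishing_def Pi_space_def g(1,2))
  have s'_not: "s' \<notin> (*) r' ` Pi_space 1"
    using s_not by (auto simp: g(1,2) mult.assoc)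
  \<comment> \<open>If \<open>r'\<close> is constant, \<open>s'_not\<close> forces \<open>s'\<close>
    to have degree at least 2 and the degree bound for \<open>s\<close> suffices; otherwise the
    bound for \<open>r\<close> does.\<close>
  have g_deg: "total_degree g \<le> k - 2"
  proof (cases "total_degree r' = 0")
    case True
    then have "r' \<in> bipoly.span (monomial ` exps 1)"
      using Pi_space_eq_span[of 0] by (auto simp: Pi_space_def)
    moreover have "monomial ` exps 1 = {1}"
    proof -
      have "exps 1 = {(0, 0)}" by (auto simp: exps_def)
      then show ?thesis by (simp add: monomial_def one_pCons monom_0)
    qed
    ultimately obtain c where c: "r' = smult [:c:] 1" by (auto simp: bipoly.span_singleton)
    with r'0 have "c \<noteq> 0" by auto
    then have "s' = r' * smult [:1 / c:] s'" by (simp add: c flip: one_pCons)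
    with s'_not have "smult [:1 / c:] s' \<notin> Pi_space 1" by blast
    then have "s' \<notin> Pi_space 1" using bipoly.subspace_scale[OF subspace_Pi_space] by blast
    then show ?thesis using s_deg k(1) by (simp add: Pi_space_def)
  next
    case False
    then show ?thesis using r_deg k(1) by simp
  qed
  have "card (X - nodes_on g X) \<le> 2"
  proof (rule common_zeros_le_2)
    show "r' \<in> Pi_space 1" "s' \<in> Pi_space 2" using r'_deg s'_deg by (auto simp: Pi_space_def)
    fix A assume "A \<in> X - nodes_on g X"
    then show "eval r' A = 0 \<and> eval s' A = 0"
      using r(1) s by (auto simp: vanishing_def nodes_on_def g(1,2))
  qed (use r'0 s'_not X(1) in auto)
  moreover have split: "card X = card (nodes_on g X) + card (X - nodes_on g X)"
    using X(1) card_Int_Diff[of X "nodes_on g X"] by (simp add: nodes_on_def Int_def)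
  ultimately have ge: "d n (k - 2) \<le> card (nodes_on g X)" using X(3) by linarith
  have le: "card (nodes_on g X) \<le> d n (total_degree g)"
    using g_deg assms(2) by (intro card_nodes_on_le X g0) auto
  \<comment> \<open>The bounds \<open>ge\<close> and \<open>le\<close> are compared through
    \<open>N\<close>; the two instances of \<open>N_le_iff\<close> ensure that the subtractions in
    \<open>d\<close> do not truncate.\<close>
  have "N (n - total_degree g) \<le> N (n - (k - 2))"
    using ge le N_le_iff[of "n - total_degree g" n] N_le_iff[of "n - (k - 2)" n] unfolding d_def by linarith
  then have deg: "total_degree g = k - 2" using g_deg assms(1,2) by (auto simp: N_le_iff)
  then have card: "card (nodes_on g X) = d n (k - 2)" using ge le by simp
  \<comment> \<open>Here \<open>3 \<le> k\<close> makes the degree positive, as \<open>curve\<close>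
    demands.\<close>
  have "maximal_curve n X (k - 2) g"
    using deg card X assms(1,2) by (auto simp: maximal_curve_def curve_def)
  moreover have "card (X - nodes_on g X) = 2" using split card X(3) by simp
  ultimately show ?thesis by blast
qed

section \<open>Conics through two points, and the equivalence\<close>

text \<open>Products of two lines parallel to the axes, one through \<open>A\<close> and one through
  \<open>B\<close>. Two of them have top forms x^2 and y^2; the other two share the top form xy and
  differ by a nonzero equation of the line AB.\<close>

lemma four_conics:
  fixes A B :: "real \<times> real"
  assumes "A \<noteq> B"
  obtains C where "bipoly.independent C" "card C = 4" "C \<subseteq> vanishing 2 {A, B}"
proof -
  obtain a1 a2 b1 b2 where AB: "A = (a1, a2)" "B = (b1, b2)" by (metis surj_pair)
  define x :: "real \<Rightarrow> bipoly" where "x = (\<lambda>a. [:[:- a, 1:]:])"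
  define y :: "real \<Rightarrow> bipoly" where "y = (\<lambda>a. [:[:- a:], 1:])"
  have ev: "eval (x a) (s, t) = s - a" "eval (y a) (s, t) = t - a" for a s t
    by (simp_all add: x_def y_def eval_def)
  define c where "c = (\<lambda>i::nat. if i = 0 then x a1 * x b1 else if i = 1 then y a2 * y b2
    else if i = 2 then x a1 * y b2 else x b1 * y a2)"
  have Pi: "x a \<in> Pi_space 1" "y a \<in> Pi_space 1" for a
    using linear_x_in_Pi_space linear_in_Pi_space[of "-a" 0 1] by (auto simp: x_def y_def one_pCons)
  have "p * q \<in> Pi_space 2" if "p \<in> Pi_space 1" "q \<in> Pi_space 1" for p q
    using Pi_space_mult[OF that] by (simp add: numeral_2_eq_2)
  then have c: "c i \<in> vanishing 2 {A, B}" for i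
    using Pi by (auto simp: c_def vanishing_def AB ev)
  have "bipoly.independent ({} \<union> c ` {..<4}) \<and> card ({} \<union> c ` {..<4}) = card ({}::bipoly set) + card {..<4::nat}"
  proof (rule independent_mod_union)
    fix u :: "nat \<Rightarrow> real" and i :: nat assume "(\<Sum>i<4. smult [:u i:] (c i)) \<in> bipoly.span {}" and i: "i \<in> {..<4}"
    then have "(\<Sum>i<4. smult [:u i:] (c i)) = 0" by simp
    then have *: "smult [:u 0:] (c 0) + smult [:u 1:] (c 1) + smult [:u 2:] (c 2) + smult [:u 3:] (c 3) = 0"
      by (simp add: eval_nat_numeral)
    have eq: "coeff (coeff (smult [:u 0:] (c 0) + smult [:u 1:] (c 1) + smult [:u 2:] (c 2) + smult [:u 3:] (c 3)) j) l = 0" for j l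
      unfolding * by simp
    \<comment> \<open>Coefficients of x^2, y^2 and xy, in this order.\<close>
    have u: "u 0 = 0" "u 1 = 0" "u 2 + u 3 = 0"
      using eq[of 0 2] eq[of 2 0] eq[of 1 1]
      by (simp_all add: c_def x_def y_def coeff_pCons one_pCons numeral_2_eq_2 split: nat.splits)
    \<comment> \<open>Coefficients of x and y; as \<open>u 3 = - u 2\<close>, they are
      \<open>u 2\<close> times those of the line AB, which are not both zero.\<close>
    have "- (b2 * u 2) = a2 * u 3" "- (a1 * u 2) = b1 * u 3"
      using eq[of 0 1] eq[of 1 0] u
      by (simp_all add: c_def x_def y_def coeff_pCons one_pCons numeral_2_eq_2 split: nat.splits)
    moreover have u3: "u 3 = - u 2" using u by simp
    ultimately have "u 2 * (b2 - a2) = 0" "u 2 * (a1 - b1) = 0" by (simp_all add: algebra_simps)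
    then have "u 2 = 0" using assms AB by auto
    moreover have "i = 0 \<or> i = 1 \<or> i = 2 \<or> i = 3" using i by auto
    ultimately show "u i = 0" using u u3 by auto
  qed (auto simp: bipoly.independent_empty)
  then show ?thesis using that[of "c ` {..<4}"] c by auto
qed

theorem theorem3p3:
  fixes n k :: nat and X :: "(real \<times> real) set"
  assumes "3 \<le> k" and "k \<le> n - 1"
    and "finite X" and "n_independent n X" and "card X = d n (k - 2) + 2"
  shows "(\<exists>S. card S = 4 \<and> bipoly.independent S \<and>
            (\<forall>p\<in>S. curve p \<and> total_degree p \<le> k \<and> nodes_on p X = X))
     \<longleftrightarrow> (\<exists>q. maximal_curve n X (k - 2) q \<and> card (X - nodes_on q X) = 2)"
proof
  assume "\<exists>S. card S = 4 \<and> bipoly.independent S \<and>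
            (\<forall>p\<in>S. curve p \<and> total_degree p \<le> k \<and> nodes_on p X = X)"
  then obtain S where S: "bipoly.independent S" "card S = 4"
    "\<And>p. p \<in> S \<Longrightarrow> total_degree p \<le> k \<and> nodes_on p X = X" by blast
  then have "S \<subseteq> vanishing k X" by (fastforce simp: vanishing_def Pi_space_def nodes_on_def)
  then show "\<exists>q. maximal_curve n X (k - 2) q \<and> card (X - nodes_on q X) = 2"
    using maximal_curve_if_four_curves assms S by blast
next
  assume "\<exists>q. maximal_curve n X (k - 2) q \<and> card (X - nodes_on q X) = 2"
  then obtain q A B where q: "maximal_curve n X (k - 2) q" and AB: "A \<noteq> B" "X - nodes_on q X = {A, B}"
    unfolding card_2_iff by metis
  then have deg: "total_degree q = k - 2" and q0: "q \<noteq> 0"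
    by (auto simp: maximal_curve_def curve_def total_degree_def)
  obtain C where C: "bipoly.independent C" "card C = 4" "C \<subseteq> vanishing 2 {A, B}"
    using four_conics[OF AB(1)] .
  have "curve p \<and> total_degree p \<le> k \<and> nodes_on p X = X" if "p \<in> (*) q ` C" for p
  proof -
    from that obtain c where c: "c \<in> C" "p = q * c" by blast
    \<comment> \<open>With both factors nonzero the degree of \<open>p\<close> is known exactly; it
      is at least \<open>k - 2\<close>, hence positive, so \<open>p\<close> is a curve.\<close>
    have "c \<noteq> 0" using C(1) c(1) bipoly.dependent_zero by blast
    then have "total_degree p = k - 2 + total_degree c" using total_degree_mult[OF q0] deg c(2) by simp
    moreover have cv: "c \<in> vanishing 2 {A, B}" using C(3) c(1) by blast
    then have "total_degree c \<le> 2" by (simp add: vanishing_def Pi_space_def)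
    moreover have "eval p D = 0" if "D \<in> X" for D
      using that AB(2) cv by (cases "D \<in> nodes_on q X") (auto simp: c(2) nodes_on_def vanishing_def)
    ultimately show ?thesis using assms(1) by (auto simp: curve_def nodes_on_def)
  qed
  moreover have "card ((*) q ` C) = 4" using card_mult_image[OF q0] C(2) by simp
  moreover have "bipoly.independent ((*) q ` C)" by (rule independent_mult_image[OF C(1) q0])
  ultimately show "\<exists>S. card S = 4 \<and> bipoly.independent S \<and>
            (\<forall>p\<in>S. curve p \<and> total_degree p \<le> k \<and> nodes_on p X = X)" by blast
qed

end
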